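(* Let $n\ge 1$ and let $R_2$ be the $(n+1)$-dimensional complex solvable Leibniz algebra with basis $\{f_1,\dots,f_n,x\}$ and multiplication $$[f_i,x]=f_i+f_{i+1},\quad [x,f_i]=-f_i-f_{i+1}\ (1\le i\le n-1),\qquad [f_n,x]=f_n,\quad [x,f_n]=-f_n,$$ all other products of basis elements being zero. Then $R_2$ admits a $2$-local derivation which is not a derivation.
   Context: A (right) Leibniz algebra is a vector space $\mathcal L$ with a bilinear bracket satisfying $[x,[y,z]]=[[x,y],z]-[[x,z],y]$ for all $x,y,z$. A derivation of $\mathcal L$ is a linear map $D:\mathcal L\to\mathcal L$ with $D([x,y])=[D(x),y]+[x,D(y)]$ for all $x,y\in\mathcal L$. A $2$-local derivation of $\mathcal L$ is a map $\nabla:\mathcal L\to\mathcal L$ (not necessarily linear) such that for all $x,y\in\mathcal L$ there is a derivation $D_{x,y}$ of $\mathcal L$ (depending on $x,y$) with $\nabla(x)=D_{x,y}(x)$ and $\nabla(y)=D_{x,y}(y)$. *)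

theory Defs
  imports Complex_Main "HOL-Computational_Algebra.Polynomial"
begin

text \<open>
  Algebras live on a subspace \<open>L\<close> of an ambient vector space, so that the dimension can be an
  arbitrary natural number. All maps are total functions on the ambient type; only their values
  on \<open>L\<close> matter.
\<close>

locale algebra_on = vector_space scale
  for scale :: "'k::field \<Rightarrow> 'a::ab_group_add \<Rightarrow> 'a" +
  fixes L :: "'a set" and br :: "'a \<Rightarrow> 'a \<Rightarrow> 'a"
  assumes subspace_L: "subspace L"
    and br_closed: "\<lbrakk>u \<in> L; v \<in> L\<rbrakk> \<Longrightarrow> br u v \<in> L"
    and br_add_left: "\<lbrakk>u \<in> L; v \<in> L; w \<in> L\<rbrakk> \<Longrightarrow> br (u + v) w = br u w + br v w"
    and br_add_right: "\<lbrakk>u \<in> L; v \<in> L; w \<in> L\<rbrakk> \<Longrightarrow> br u (v + w) = br u v + br u w"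
    and br_scale_left: "\<lbrakk>u \<in> L; v \<in> L\<rbrakk> \<Longrightarrow> br (scale c u) v = scale c (br u v)"
    and br_scale_right: "\<lbrakk>u \<in> L; v \<in> L\<rbrakk> \<Longrightarrow> br u (scale c v) = scale c (br u v)"
begin

definition derivation :: "('a \<Rightarrow> 'a) \<Rightarrow> bool" where
  "derivation D \<longleftrightarrow>
     (\<forall>u\<in>L. D u \<in> L) \<and>
     (\<forall>u\<in>L. \<forall>v\<in>L. D (u + v) = D u + D v) \<and>
     (\<forall>c. \<forall>u\<in>L. D (scale c u) = scale c (D u)) \<and>
     (\<forall>u\<in>L. \<forall>v\<in>L. D (br u v) = br (D u) v + br u (D v))"

definition two_local_derivation :: "('a \<Rightarrow> 'a) \<Rightarrow> bool" where
  "two_local_derivation T \<longleftrightarrow>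
     (\<forall>u\<in>L. T u \<in> L) \<and>
     (\<forall>u\<in>L. \<forall>v\<in>L. \<exists>D. derivation D \<and> T u = D u \<and> T v = D v)"

primrec derived_series :: "nat \<Rightarrow> 'a set" where
  "derived_series 0 = L"
| "derived_series (Suc k) =
     span {br u v | u v. u \<in> derived_series k \<and> v \<in> derived_series k}"

definition solvable :: bool where
  "solvable \<longleftrightarrow> (\<exists>k. derived_series k = {0})"

end

locale leibniz_algebra = algebra_on +
  assumes leibniz: "\<lbrakk>u \<in> L; v \<in> L; w \<in> L\<rbrakk> \<Longrightarrow> br u (br v w) = br (br u v) w - br (br u w) v"

text \<open>
  The algebra $R_2$. The Leibniz identity and solvability are not assumed: they follow from the
  multiplication table and are proved below.
\<close>

locale R2_algebra = algebra_on scale L br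
  for scale :: "complex \<Rightarrow> 'a::ab_group_add \<Rightarrow> 'a" and L br +
  fixes n :: nat and f :: "nat \<Rightarrow> 'a" and x :: 'a
  assumes inj_f: "inj_on f {1..n}"
    and x_notin_f: "x \<notin> f ` {1..n}"
    and independent_basis: "independent (insert x (f ` {1..n}))"
    and span_basis: "span (insert x (f ` {1..n})) = L"
    and br_f_x: "\<lbrakk>1 \<le> i; i < n\<rbrakk> \<Longrightarrow> br (f i) x = f i + f (i + 1)"
    and br_x_f: "\<lbrakk>1 \<le> i; i < n\<rbrakk> \<Longrightarrow> br x (f i) = - f i - f (i + 1)"
    and br_fn_x: "1 \<le> n \<Longrightarrow> br (f n) x = f n"
    and br_x_fn: "1 \<le> n \<Longrightarrow> br x (f n) = - f n"
    and br_f_f: "\<lbrakk>i \<in> {1..n}; j \<in> {1..n}\<rbrakk> \<Longrightarrow> br (f i) (f j) = 0"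
    and br_x_x: "br x x = 0"
begin

definition F :: "'a set" where "F = span (f ` {1..n})"

lemma F_subset: "F \<subseteq> L"
  unfolding F_def span_basis[symmetric] by (rule span_mono) auto

lemma x_in_L: "x \<in> L"
  unfolding span_basis[symmetric] by (rule span_base) simp

lemma f_in_F: "i \<in> {1..n} \<Longrightarrow> f i \<in> F"
  unfolding F_def by (rule span_base) simp

lemma subspace_F: "subspace F"
  unfolding F_def by (rule subspace_span)

lemma L_decomp:
  assumes "u \<in> L"
  obtains a v where "v \<in> F" "u = v + scale a x"
proof -
  from assms obtain a where "u - scale a x \<in> F"
    unfolding span_basis[symmetric] F_def span_insert by blast
  then show ?thesis using that[of "u - scale a x" a] by simp
qed

lemma zero_br:
  assumes "u \<in> L"
  shows "br 0 u = 0" "br u 0 = 0"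
  using br_scale_left[OF assms assms, of 0] br_scale_right[OF assms assms, of 0] by simp_all

lemma F_induct [consumes 1, case_names zero add gen]:
  assumes "u \<in> F"
    and "P 0"
    and "\<And>u v c. \<lbrakk>u \<in> F; v \<in> F; P u; P v\<rbrakk> \<Longrightarrow> P (scale c u + v)"
    and "\<And>i. i \<in> {1..n} \<Longrightarrow> P (f i)"
  shows "P u"
proof -
  have "u \<in> F \<and> P u"
    using assms(1)[unfolded F_def]
  proof (induction rule: span_induct_alt)
    case base
    then show ?case using assms(2) subspace_0[OF subspace_F] by simp
  next
    case (step c u v)
    then have "u \<in> F" "P u" "v \<in> F" "P v"
      using f_in_F assms(4) by auto
    then show ?case
      using assms(3) subspace_add[OF subspace_F] subspace_scale[OF subspace_F] by blast
  qed
  then show ?thesis by simp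
qed

lemma br_F_x: "u \<in> F \<Longrightarrow> br u x \<in> F \<and> br x u = - br u x"
proof (induction rule: F_induct)
  case zero
  then show ?case using zero_br[OF x_in_L] subspace_0[OF subspace_F] by simp
next
  case (add u v c)
  then have L: "u \<in> L" "v \<in> L" "scale c u \<in> L"
    using F_subset subspace_scale[OF subspace_L] by auto
  have "br (scale c u + v) x = scale c (br u x) + br v x"
    "br x (scale c u + v) = scale c (br x u) + br x v"
    using L x_in_L by (simp_all add: br_add_left br_add_right br_scale_left br_scale_right)
  with add show ?case
    using subspace_add[OF subspace_F] subspace_scale[OF subspace_F]
    by simp
next
  case (gen i)
  show ?case
  proof (cases "i = n")
    case True
    then show ?thesis using gen br_fn_x br_x_fn f_in_F by auto
  next
    case False
    then show ?thesis
      using gen br_f_x[of i] br_x_f[of i] f_in_F[of i] f_in_F[of "i + 1"]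
        subspace_add[OF subspace_F] by auto
  qed
qed

lemma br_f_F:
  assumes "i \<in> {1..n}" "v \<in> F"
  shows "br (f i) v = 0"
  using assms(2)
proof (induction rule: F_induct)
  case zero
  then show ?case using zero_br f_in_F[OF assms(1)] F_subset by auto
next
  case (add u v c)
  then have "u \<in> L" "v \<in> L" "scale c u \<in> L" "f i \<in> L"
    using F_subset subspace_scale[OF subspace_L] f_in_F[OF assms(1)] by auto
  with add show ?case by (simp add: br_add_right br_scale_right)
next
  case (gen j)
  with assms(1) show ?case by (rule br_f_f)
qed

lemma br_F_F:
  assumes "u \<in> F" "v \<in> F"
  shows "br u v = 0"
  using assms(1)
proof (induction rule: F_induct)
  case zero
  then show ?case using zero_br assms(2) F_subset by auto
next
  case (add u w c)
  then have "u \<in> L" "w \<in> L" "scale c u \<in> L" "v \<in> L"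
    using F_subset subspace_scale[OF subspace_L] assms(2) by auto
  with add show ?case by (simp add: br_add_left br_scale_left)
next
  case (gen i)
  then show ?case using br_f_F assms(2) by blast
qed

lemma br_decomp:
  assumes "u \<in> F" "v \<in> F"
  shows "br (u + scale a x) (v + scale b x) = scale b (br u x) - scale a (br v x)"
proof -
  have L: "u \<in> L" "v \<in> L" "scale a x \<in> L" "scale b x \<in> L" "v + scale b x \<in> L"
    using assms F_subset x_in_L subspace_scale[OF subspace_L] subspace_add[OF subspace_L] by auto
  show ?thesis
    using L x_in_L assms
    by (simp add: br_add_left br_add_right br_scale_left br_scale_right br_F_F br_F_x br_x_x)
qed

lemma br_in_F:
  assumes "u \<in> L" "v \<in> L"
  shows "br u v \<in> F"
  using L_decomp[OF assms(1)] L_decomp[OF assms(2)] br_decomp br_F_x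
    subspace_diff[OF subspace_F] subspace_scale[OF subspace_F] by metis

lemma is_leibniz_algebra: "leibniz_algebra scale L br"
proof unfold_locales
  fix p q r assume "p \<in> L" "q \<in> L" "r \<in> L"
  then obtain a b c u v w where F: "u \<in> F" "v \<in> F" "w \<in> F"
    and eqs: "p = u + scale a x" "q = v + scale b x" "r = w + scale c x"
    using L_decomp by metis
  define T where "T z = br z x" for z
  have TF: "T z \<in> F" if "z \<in> F" for z using br_F_x that by (simp add: T_def)
  have D: "br (y + scale d x) (z + scale e x) = scale e (T y) - scale d (T z)"
    if "y \<in> F" "z \<in> F" for y z d e
    using br_decomp that by (simp add: T_def)
  have comb: "scale d y - scale e z \<in> F" if "y \<in> F" "z \<in> F" for y z d e
    using that by (intro subspace_diff[OF subspace_F] subspace_scale[OF subspace_F])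
  have T_comb: "T (scale d y - scale e z) = scale d (T y) - scale e (T z)"
    if "y \<in> F" "z \<in> F" for y z d e
  proof -
    have L: "scale d y \<in> L" "scale (- e) z \<in> L" "y \<in> L" "z \<in> L"
      using that F_subset subspace_scale[OF subspace_L] by blast+
    have "T (scale d y + scale (- e) z) = scale d (T y) + scale (- e) (T z)"
      unfolding T_def using L x_in_L by (simp only: br_add_left br_scale_left)
    then show ?thesis by simp
  qed
  have left: "br (y + scale d x) z = - scale d (T z)" if "y \<in> F" "z \<in> F" for y z d
    using D[OF that, of d 0] by simp
  have right: "br z (y + scale d x) = scale d (T z)" if "y \<in> F" "z \<in> F" for y z d
    using D[OF that(2,1), of 0 d] by simp
  show "br p (br q r) = br (br p q) r - br (br p r) q"
    unfolding eqs
    using F TF comb by (simp add: D left right T_comb scale_right_diff_distrib mult.commute)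
qed

lemma is_solvable: solvable
proof -
  have 1: "derived_series 1 \<subseteq> F"
    unfolding One_nat_def derived_series.simps
    by (rule span_minimal) (use br_in_F subspace_F in auto)
  have "{br u v | u v. u \<in> derived_series 1 \<and> v \<in> derived_series 1} \<subseteq> {0}"
    using 1 br_F_F by blast
  then have "derived_series (Suc 1) \<subseteq> {0}"
    unfolding derived_series.simps(2)[of 1] by (rule span_minimal) (rule subspace_single_0)
  moreover have "0 \<in> derived_series (Suc 1)"
    unfolding derived_series.simps(2)[of 1] by (rule span_zero)
  ultimately show ?thesis unfolding solvable_def by blast
qed

lemma dim_L: "dim L = n + 1"
proof -
  have "dim L = card (insert x (f ` {1..n}))"
    unfolding span_basis[symmetric]
    by (rule dim_unique[OF span_superset order_refl independent_basis refl])
  then show ?thesis using x_notin_f inj_f by (simp add: card_image)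
qed

end

text \<open>
  For every \<open>n\<close> such an algebra exists: on the polynomials of degree at most \<open>n\<close>, with
  $x = 1$ and $f_i = X^i$.
\<close>

lemma R2_algebra_exists:
  "\<exists>(L :: complex poly set) br f x. R2_algebra smult L br n f x"
proof -
  define L :: "complex poly set" where "L = {p. degree p \<le> n}"
  define f :: "nat \<Rightarrow> complex poly" where "f = monom 1"
  define T :: "complex poly \<Rightarrow> complex poly" where
    "T p = (\<Sum>i=1..n. smult (coeff p i) (f i + (if i < n then f (i + 1) else 0)))" for p
  define br :: "complex poly \<Rightarrow> complex poly \<Rightarrow> complex poly" where
    "br p q = smult (coeff q 0) (T p) - smult (coeff p 0) (T q)" for p q
  interpret vector_space "smult :: complex \<Rightarrow> _"
    by unfold_locales (simp_all add: smult_add_right smult_add_left)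
  have basis: "insert 1 (f ` {1..n}) = f ` {..n}"
  proof -
    have "{..n} = insert 0 {1..n}" by auto
    then show ?thesis by (simp add: f_def)
  qed
  have inj: "inj_on f A" for A by (auto simp: inj_on_def f_def monom_eq_iff')
  have sub: "subspace L"
    unfolding subspace_def L_def
    by (auto intro: degree_add_le order_trans[OF degree_smult_le])
  have f_L: "f i \<in> L" if "i \<le> n" for i
    using that by (simp add: f_def L_def degree_monom_eq)
  have T_L: "T p \<in> L" for p
    unfolding T_def
    by (intro subspace_sum[OF sub] subspace_scale[OF sub] subspace_add[OF sub])
      (auto intro: f_L subspace_0[OF sub])
  have T_add: "T (p + q) = T p + T q" for p q
    by (simp add: T_def smult_add_left sum.distrib)
  have T_smult: "T (smult c p) = smult c (T p)" for c p
    by (simp add: T_def scale_sum_right)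
  have T_f: "T (f i) = f i + (if i < n then f (i + 1) else 0)" if "i \<in> {1..n}" for i
  proof -
    have "T (f i) = (\<Sum>j=1..n. if i = j then f j + (if j < n then f (j + 1) else 0) else 0)"
      unfolding T_def by (rule sum.cong) (auto simp: f_def)
    also have "\<dots> = f i + (if i < n then f (i + 1) else 0)"
      using that by (subst sum.delta') auto
    finally show ?thesis .
  qed
  have T_1: "T 1 = 0"
    unfolding T_def by (rule sum.neutral) auto
  have c0: "coeff (f i) 0 = 0" if "i \<in> {1..n}" for i
    using that by (simp add: f_def)
  have indep: "independent (f ` {..n})"
  proof (rule independent_if_scalars_zero)
    fix g p assume s: "(\<Sum>q\<in>f ` {..n}. smult (g q) q) = 0" and "p \<in> f ` {..n}"
    then obtain i where i: "i \<le> n" "p = f i" by auto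
    have "0 = coeff (\<Sum>j\<le>n. smult (g (f j)) (f j)) i"
      using s by (simp add: sum.reindex[OF inj])
    also have "\<dots> = (\<Sum>j\<le>n. if j = i then g (f j) else 0)"
      unfolding coeff_sum by (rule sum.cong) (auto simp: f_def)
    also have "\<dots> = g p" using i by simp
    finally show "g p = 0" by simp
  qed simp
  have span: "span (f ` {..n}) = L"
  proof
    show "span (f ` {..n}) \<subseteq> L"
      by (rule span_minimal) (auto intro: f_L sub)
    show "L \<subseteq> span (f ` {..n})"
    proof
      fix p assume "p \<in> L"
      then have "p = (\<Sum>i\<le>n. smult (coeff p i) (f i))"
        using poly_as_sum_of_monoms'[of p n] by (simp add: L_def f_def smult_monom)
      also have "\<dots> \<in> span (f ` {..n})"
        by (intro span_sum span_scale span_base) auto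
      finally show "p \<in> span (f ` {..n})" .
    qed
  qed
  have "R2_algebra smult L br n f 1"
  proof
    show "br u v \<in> L" for u v
      unfolding br_def by (intro subspace_diff[OF sub] subspace_scale[OF sub] T_L)
    show "1 \<notin> f ` {1..n}" using c0 by force
  qed (use sub basis indep span c0 in
      \<open>auto simp: inj br_def T_add T_smult T_f T_1 algebra_simps smult_add_left
        smult_add_right smult_diff_right\<close>)
  then show ?thesis by blast
qed

end

theory Submission imports Defs begin

text \<open>
  For a vector \<open>w\<close> let \<open>\<lambda> w\<close> and \<open>\<chi> w\<close> be its coordinates at \<open>f 1\<close> and at \<open>x\<close>. Right multiplication
  by \<open>x\<close> is a single Jordan block with eigenvalue \<open>1\<close> on the span of the \<open>f i\<close>: it fixes \<open>f n\<close>, and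
  it preserves the coordinate \<open>\<lambda>\<close>, because no \<open>f i\<close> with \<open>i \<ge> 2\<close> contributes to \<open>f 1\<close>. So for all
  scalars \<open>\<alpha>, \<beta>\<close> the rank-one map \<open>w \<mapsto> (\<alpha> \<lambda> w + \<beta> \<chi> w) f n\<close> is a derivation
  (\<open>derivation_into_eigenline\<close>).

  This two-parameter family realises every linear form in the pair \<open>(\<lambda> w, \<chi> w)\<close>. A function of two
  variables that is homogeneous of degree one agrees with some linear form at any two prescribed
  points (\<open>homogeneous_eq_linear_at_two_points\<close>): at independent points the linear form can be chosen
  freely, and at proportional points homogeneity makes the second condition follow from the first.
  Hence \<open>w \<mapsto> \<phi> (\<lambda> w) (\<chi> w) f n\<close> is a 2-local derivation for every such \<open>\<phi>\<close>, and a \<open>\<phi>\<close> that is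
  not additive, such as \<open>p\<^sup>2 / q\<close> extended by \<open>0\<close> to \<open>q = 0\<close>, yields one that is not linear.
\<close>

lemma homogeneous_eq_linear_at_two_points:
  fixes \<phi> :: "'k::field \<Rightarrow> 'k \<Rightarrow> 'k"
  assumes hom: "\<And>c p q. \<phi> (c * p) (c * q) = c * \<phi> p q"
  shows "\<exists>\<alpha> \<beta>. \<phi> p q = \<alpha> * p + \<beta> * q \<and> \<phi> p' q' = \<alpha> * p' + \<beta> * q'"
proof -
  have one: "\<exists>\<alpha> \<beta>. \<phi> r s = \<alpha> * r + \<beta> * s" for r s
  proof -
    consider "r \<noteq> 0" | "s \<noteq> 0" | "r = 0" "s = 0" by blast
    then show ?thesis
    proof cases
      case 1
      then have "\<phi> r s = (\<phi> r s / r) * r + 0 * s" by simp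
      then show ?thesis by blast
    next
      case 2
      then have "\<phi> r s = 0 * r + (\<phi> r s / s) * s" by simp
      then show ?thesis by blast
    next
      case 3
      then show ?thesis using hom[of 0 0 0] by simp
    qed
  qed
  have proportional: ?thesis if "p' = c * p" "q' = c * q" for c
  proof -
    obtain \<alpha> \<beta> where "\<phi> p q = \<alpha> * p + \<beta> * q" using one by blast
    moreover from this have "\<phi> p' q' = \<alpha> * p' + \<beta> * q'"
      by (simp add: that hom algebra_simps)
    ultimately show ?thesis by blast
  qed
  define d where "d = p * q' - p' * q"
  consider "d \<noteq> 0" | "d = 0" "p \<noteq> 0" | "d = 0" "q \<noteq> 0" | "p = 0" "q = 0" by blast
  then show ?thesis
  proof cases
    case 1
    \<comment> \<open>Cramer's rule\<close>
    define \<alpha> \<beta> where "\<alpha> = (\<phi> p q * q' - \<phi> p' q' * q) / d"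
      and "\<beta> = (p * \<phi> p' q' - p' * \<phi> p q) / d"
    have "\<alpha> * p + \<beta> * q = \<phi> p q * d / d" "\<alpha> * p' + \<beta> * q' = \<phi> p' q' * d / d"
      unfolding \<alpha>_def \<beta>_def times_divide_eq_left add_divide_distrib[symmetric]
      by (simp_all add: d_def algebra_simps)
    with 1 have "\<phi> p q = \<alpha> * p + \<beta> * q \<and> \<phi> p' q' = \<alpha> * p' + \<beta> * q'" by simp
    then show ?thesis by blast
  next
    case 2
    then show ?thesis by (intro proportional[of "p' / p"]) (simp_all add: d_def field_simps)
  next
    case 3
    then show ?thesis by (intro proportional[of "q' / q"]) (simp_all add: d_def field_simps)
  next
    case 4
    obtain \<alpha> \<beta> where "\<phi> p' q' = \<alpha> * p' + \<beta> * q'" using one by blast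
    moreover have "\<phi> p q = \<alpha> * p + \<beta> * q" using 4 hom[of 0 0 0] by simp
    ultimately show ?thesis by blast
  qed
qed

context R2_algebra
begin

definition coord :: "'a \<Rightarrow> 'a \<Rightarrow> complex" where
  "coord b w = representation (insert x (f ` {1..n})) w b"

lemma coord_add: "\<lbrakk>u \<in> L; v \<in> L\<rbrakk> \<Longrightarrow> coord b (u + v) = coord b u + coord b v"
  unfolding coord_def using independent_basis span_basis by (simp add: representation_add)

lemma coord_scale: "u \<in> L \<Longrightarrow> coord b (scale c u) = c * coord b u"
  unfolding coord_def using independent_basis span_basis by (simp add: representation_scale)

lemma coord_diff: "\<lbrakk>u \<in> L; v \<in> L\<rbrakk> \<Longrightarrow> coord b (u - v) = coord b u - coord b v"
  unfolding coord_def using independent_basis span_basis by (simp add: representation_diff)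

lemma coord_basis:
  "b' \<in> insert x (f ` {1..n}) \<Longrightarrow> coord b b' = (if b = b' then 1 else 0)"
  unfolding coord_def using independent_basis by (auto simp: representation_basis)

lemma coord_f_f:
  "\<lbrakk>i \<in> {1..n}; j \<in> {1..n}\<rbrakk> \<Longrightarrow> coord (f i) (f j) = (if i = j then 1 else 0)"
  using inj_f by (auto simp: coord_basis inj_on_eq_iff)

lemma coord_f_x: "i \<in> {1..n} \<Longrightarrow> coord (f i) x = 0"
  using x_notin_f by (auto simp: coord_basis)

lemma coord_x_x: "coord x x = 1"
  by (simp add: coord_basis)

lemma coord_x_F: "v \<in> F \<Longrightarrow> coord x v = 0"
proof (induction rule: F_induct)
  case zero
  then show ?case using coord_scale[OF x_in_L, of x 0] by simp
next
  case (add u v c)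
  then have "u \<in> L" "v \<in> L" "scale c u \<in> L"
    using F_subset subspace_scale[OF subspace_L] by auto
  with add show ?case by (simp add: coord_add coord_scale)
next
  case (gen i)
  then show ?case using x_notin_f by (auto simp: coord_basis)
qed

lemma L_decomp_coord:
  assumes "u \<in> L"
  obtains v where "v \<in> F" "u = v + scale (coord x u) x"
proof -
  obtain a v where v: "v \<in> F" "u = v + scale a x" using L_decomp[OF assms] .
  have "v \<in> L" "scale a x \<in> L"
    using v(1) F_subset subspace_scale[OF subspace_L x_in_L] by blast+
  then have "coord x u = a"
    unfolding v(2) using v(1) x_in_L by (simp add: coord_add coord_scale coord_x_F coord_x_x)
  then show ?thesis using that v by simp
qed

lemma coord_f1_br_x:
  assumes n: "1 \<le> n" and "v \<in> F"
  shows "coord (f 1) (br v x) = coord (f 1) v"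
  using assms(2)
proof (induction rule: F_induct)
  case zero
  then show ?case using zero_br[OF x_in_L] by simp
next
  case (add u v c)
  then have "u \<in> L" "v \<in> L" "scale c u \<in> L" "br u x \<in> L" "br v x \<in> L"
    "scale c (br u x) \<in> L"
    using F_subset subspace_scale[OF subspace_L] br_closed x_in_L by auto
  with add x_in_L show ?case by (simp add: br_add_left br_scale_left coord_add coord_scale)
next
  case (gen i)
  show ?case
  proof (cases "i = n")
    case True
    then show ?thesis using br_fn_x[OF n] by simp
  next
    case False
    then have i: "1 \<le> i" "i < n" and mem: "f i \<in> L" "f (i + 1) \<in> L"
      using gen f_in_F[of i] f_in_F[of "i + 1"] F_subset by auto
    have "coord (f 1) (f (i + 1)) = 0"
      using i n coord_f_f[of 1 "i + 1"] by simp
    then show ?thesis using br_f_x[OF i] coord_add[OF mem] by simp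
  qed
qed

lemma coord_f1_br:
  assumes n: "1 \<le> n" and "u \<in> L" "w \<in> L"
  shows "coord (f 1) (br u w) = coord x w * coord (f 1) u - coord x u * coord (f 1) w"
proof -
  obtain u' where u': "u' \<in> F" "u = u' + scale (coord x u) x"
    using L_decomp_coord[OF assms(2)] .
  obtain w' where w': "w' \<in> F" "w = w' + scale (coord x w) x"
    using L_decomp_coord[OF assms(3)] .
  have f1: "coord (f 1) (v + scale a x) = coord (f 1) v" if "v \<in> F" for v a
    using that F_subset x_in_L subspace_scale[OF subspace_L x_in_L] n
    by (auto simp: coord_add coord_scale coord_f_x)
  have mem: "br u' x \<in> L" "br w' x \<in> L"
    using u'(1) w'(1) br_F_x F_subset by auto
  have "br u w = scale (coord x w) (br u' x) - scale (coord x u) (br w' x)"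
    using br_decomp[OF u'(1) w'(1), of "coord x u" "coord x w"]
    by (simp only: u'(2)[symmetric] w'(2)[symmetric])
  then have "coord (f 1) (br u w) = coord x w * coord (f 1) u' - coord x u * coord (f 1) w'"
    using mem subspace_scale[OF subspace_L] coord_f1_br_x[OF n] u'(1) w'(1)
    by (simp add: coord_diff coord_scale)
  moreover have "coord (f 1) u = coord (f 1) u'" "coord (f 1) w = coord (f 1) w'"
    using f1[OF u'(1), of "coord x u"] f1[OF w'(1), of "coord x w"]
    by (simp_all only: u'(2)[symmetric] w'(2)[symmetric])
  ultimately show ?thesis by simp
qed

lemma br_fn:
  assumes n: "1 \<le> n" and "w \<in> L"
  shows "br (f n) w = scale (coord x w) (f n)" "br w (f n) = - scale (coord x w) (f n)"
proof -
  obtain w' where w': "w' \<in> F" "w = w' + scale (coord x w) x"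
    using L_decomp_coord[OF assms(2)] .
  have fn: "f n \<in> F" using n f_in_F by simp
  show "br (f n) w = scale (coord x w) (f n)"
    using br_decomp[OF fn w'(1), of 0 "coord x w"] br_fn_x[OF n]
    by (simp flip: w'(2))
  show "br w (f n) = - scale (coord x w) (f n)"
    using br_decomp[OF w'(1) fn, of "coord x w" 0] br_fn_x[OF n]
    by (simp flip: w'(2))
qed

text \<open>
  Both sides of the Leibniz rule lie on the line of \<open>f n\<close>. In \<open>[D u, w] + [u, D w]\<close> the two terms
  \<open>\<beta> \<chi> u \<chi> w\<close> cancel by antisymmetry, which leaves \<open>\<alpha> (\<chi> w \<lambda> u - \<chi> u \<lambda> w)\<close>; this is
  \<open>\<alpha> \<lambda> [u, w]\<close>, and \<open>\<chi>\<close> vanishes on products.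
\<close>

lemma derivation_into_eigenline:
  assumes n: "1 \<le> n"
  shows "derivation (\<lambda>w. scale (\<alpha> * coord (f 1) w + \<beta> * coord x w) (f n))"
proof -
  have fn: "f n \<in> L" using n f_in_F[of n] F_subset by auto
  show ?thesis
    unfolding derivation_def
  proof (intro conjI ballI allI)
    fix u w assume L: "u \<in> L" "w \<in> L"
    show "scale (\<alpha> * coord (f 1) (u + w) + \<beta> * coord x (u + w)) (f n)
        = scale (\<alpha> * coord (f 1) u + \<beta> * coord x u) (f n)
          + scale (\<alpha> * coord (f 1) w + \<beta> * coord x w) (f n)"
      using L by (simp add: coord_add algebra_simps)
    have "scale (\<alpha> * coord (f 1) (br u w) + \<beta> * coord x (br u w)) (f n)
        = scale (\<alpha> * (coord x w * coord (f 1) u - coord x u * coord (f 1) w)) (f n)"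
      using coord_f1_br[OF n L] coord_x_F[OF br_in_F[OF L]] by simp
    also have "\<dots> = scale ((\<alpha> * coord (f 1) u + \<beta> * coord x u) * coord x w) (f n)
          - scale ((\<alpha> * coord (f 1) w + \<beta> * coord x w) * coord x u) (f n)"
      by (simp add: algebra_simps)
    also have "\<dots> = br (scale (\<alpha> * coord (f 1) u + \<beta> * coord x u) (f n)) w
          + br u (scale (\<alpha> * coord (f 1) w + \<beta> * coord x w) (f n))"
      using L fn br_fn[OF n] by (simp add: br_scale_left br_scale_right)
    finally show "scale (\<alpha> * coord (f 1) (br u w) + \<beta> * coord x (br u w)) (f n)
        = br (scale (\<alpha> * coord (f 1) u + \<beta> * coord x u) (f n)) w
          + br u (scale (\<alpha> * coord (f 1) w + \<beta> * coord x w) (f n))" .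
  next
    fix u assume "u \<in> L"
    show "scale (\<alpha> * coord (f 1) u + \<beta> * coord x u) (f n) \<in> L"
      using fn subspace_scale[OF subspace_L] by blast
  next
    fix c u assume "u \<in> L"
    then show "scale (\<alpha> * coord (f 1) (scale c u) + \<beta> * coord x (scale c u)) (f n)
        = scale c (scale (\<alpha> * coord (f 1) u + \<beta> * coord x u) (f n))"
      by (simp add: coord_scale algebra_simps)
  qed
qed

lemma two_local_derivation_of_homogeneous:
  assumes n: "1 \<le> n" and hom: "\<And>c p q. \<phi> (c * p) (c * q) = c * \<phi> p q"
  shows "two_local_derivation (\<lambda>w. scale (\<phi> (coord (f 1) w) (coord x w)) (f n))"
  unfolding two_local_derivation_def
proof (intro conjI ballI)
  fix u assume "u \<in> L"
  show "scale (\<phi> (coord (f 1) u) (coord x u)) (f n) \<in> L"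
    using n f_in_F[of n] F_subset subspace_scale[OF subspace_L] by auto
next
  fix u w assume "u \<in> L" "w \<in> L"
  obtain \<alpha> \<beta> where
    "\<phi> (coord (f 1) u) (coord x u) = \<alpha> * coord (f 1) u + \<beta> * coord x u"
    "\<phi> (coord (f 1) w) (coord x w) = \<alpha> * coord (f 1) w + \<beta> * coord x w"
    using homogeneous_eq_linear_at_two_points[of \<phi>, OF hom] by blast
  then show "\<exists>D. derivation D
      \<and> scale (\<phi> (coord (f 1) u) (coord x u)) (f n) = D u
      \<and> scale (\<phi> (coord (f 1) w) (coord x w)) (f n) = D w"
    by (intro exI[of _ "\<lambda>w. scale (\<alpha> * coord (f 1) w + \<beta> * coord x w) (f n)"])
      (simp add: derivation_into_eigenline[OF n, simplified])
qed

lemma two_local_derivation_not_derivation: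
  assumes n: "1 \<le> n"
  shows "\<exists>T. two_local_derivation T \<and> \<not> derivation T"
proof -
  \<comment> \<open>Division by zero gives \<open>0\<close>, which keeps \<open>\<phi>\<close> homogeneous on the line \<open>q = 0\<close>.\<close>
  define \<phi> :: "complex \<Rightarrow> complex \<Rightarrow> complex" where "\<phi> p q = p\<^sup>2 / q" for p q
  define T where "T w = scale (\<phi> (coord (f 1) w) (coord x w)) (f n)" for w
  have "\<phi> (c * p) (c * q) = c * \<phi> p q" for c p q
    by (cases "c = 0") (simp_all add: \<phi>_def power2_eq_square)
  then have "two_local_derivation T"
    unfolding T_def using two_local_derivation_of_homogeneous[OF n] by blast
  moreover have "\<not> derivation T"
  proof
    assume "derivation T"
    have f1: "f 1 \<in> F" using n f_in_F by simp
    then have L: "f 1 \<in> L" using F_subset by blast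
    have c: "coord (f 1) (f 1) = 1" "coord (f 1) x = 0"
      using n coord_f_f[of 1 1] coord_f_x[of 1] by simp_all
    have T: "T (f 1) = 0" "T x = 0" "T (f 1 + x) = f n"
      using coord_x_F[OF f1] coord_x_x c L x_in_L
      by (simp_all add: T_def \<phi>_def coord_add)
    have "T (f 1 + x) = T (f 1) + T x"
      using \<open>derivation T\<close> L x_in_L unfolding derivation_def by blast
    with T have "f n = 0" by simp
    moreover have "f n \<noteq> 0"
      using independent_basis n dependent_zero[of "insert x (f ` {1..n})"]
      by (metis atLeastAtMost_iff image_eqI insertCI order_refl)
    ultimately show False by simp
  qed
  ultimately show ?thesis by blast
qed

end

theorem theorem4p5:
  fixes scale :: "complex \<Rightarrow> 'a::ab_group_add \<Rightarrow> 'a"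
    and L :: "'a set" and br :: "'a \<Rightarrow> 'a \<Rightarrow> 'a"
    and n :: nat and f :: "nat \<Rightarrow> 'a" and x :: 'a
  assumes "n \<ge> 1"
    and "R2_algebra scale L br n f x"
  shows "\<exists>T. algebra_on.two_local_derivation scale L br T
           \<and> \<not> algebra_on.derivation scale L br T"
  using R2_algebra.two_local_derivation_not_derivation[OF assms(2,1)] .

end
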